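(* Let $\mathbf{C}=\{C_{ij}\}\in\mathbb{R}^{n\times n}$ be a nonnegative weight matrix, let $\eta_k\in(0,1]$ for $k\ge 1$, and let $\{\mathbf{s}_k\}_{k\ge1}$ be an arbitrary sequence of random $n\times d$ matrices. Suppose that for any $i\in\mathcal{V}=\{1,\dots,n\}$: (a) $\{\zeta_{i,k}\}$ is a collection of zero-mean independent random variables in $\mathbb{R}^d$; (b) $\{\zeta_{i,k},\mathbf{s}_k\}$ is independent for every $k$; (c) $\sum_{t=1}^\infty \eta_t=\infty$, $\sum_{t=1}^\infty\eta_t^2<\infty$, and $\sum_{t=1}^\infty \eta_t^2\,\mathbb{E}\left[\|\zeta_{i,t}\|^2\right]<\infty$. Let $\{\mathbf{z}_k\}$ be the sequence of $n\times d$ matrices generated, from an initial value $\mathbf{z}_1$, by $$\mathbf{z}_{k+1}=(1-\eta_k)\left(\mathbf{z}_k+\mathbf{C}\mathbf{s}_{k+1}-\mathbf{C}\mathbf{s}_k\right)+\eta_k\left(\mathbf{C}\mathbf{s}_{k+1}+\zeta^C_{k+1}\right),\qquad k\ge 1.$$ Then, almost surely, $$\|\mathbf{z}_k-\mathbf{C}\mathbf{s}_k\|^2\longrightarrow 0\quad\text{and}\quad \sum_{t=1}^\infty\eta_t\|\mathbf{z}_t-\mathbf{C}\mathbf{s}_t\|^2<\infty .$$ Moreover, if there exists a constant $\sigma$ such that $\mathbb{E}\left[\|\zeta_{i,t}\|^2\right]\le\sigma^2$ for all $i\in\mathcal{V}$, $t\in\mathbb{N}$, and either $\eta_k=\frac{\eta}{k^{a_1}}$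 with $\eta\in(0,1)$, $a_1\in(0.5,1)$, or $\eta_k=\frac{\eta}{k+1}$ with $\eta\in(1,2)$, then $$\mathbb{E}\left[\|\mathbf{z}_k-\mathbf{C}\mathbf{s}_k\|^2\right]\le c_\eta\,\eta_k$$ for some constant $c_\eta>0$.
   Context: For the nonnegative matrix $\mathbf{C}$ and $i\in\mathcal{V}$, $\mathcal{N}^{\rm in}_{\mathbf{C},i}=\{j\ne i: C_{ij}>0\}$ is the set of in-neighbors of agent $i$. The matrix $\zeta^C_k\in\mathbb{R}^{n\times d}$ has $i$-th row $\big(\sum_{j\in\mathcal{N}^{\rm in}_{\mathbf{C},i}}\zeta_{j,k}\big)^\intercal$. The norm $\|\cdot\|$ on $\mathbb{R}^{d}$ is Euclidean, and on $\mathbb{R}^{n\times d}$ it is the square root of the sum of the squared Euclidean norms of the columns (the Frobenius norm).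
   Formalization: In (c) the third series is taken as the sum of η_t² E‖ζ_{i,t+1}‖² (with ζ_{i,t} as printed the claim is false), and the "Moreover" part additionally assumes E‖z_1 − C s_1‖² < ∞, which is necessary for the bound at k = 1. *)

theory Defs
  imports "HOL-Probability.Probability"
begin

definition in_neighbors :: "real ^ 'n ^ 'n \<Rightarrow> 'n \<Rightarrow> 'n set" where
  "in_neighbors C i = {j. j \<noteq> i \<and> C $ i $ j > 0}"

text \<open>The neighbour sum below is unweighted: the entries of \<open>C\<close> enter only through their support.\<close>

definition neighbor_noise ::
  "real ^ 'n ^ 'n \<Rightarrow> ('n \<Rightarrow> nat \<Rightarrow> 'w \<Rightarrow> real ^ 'd) \<Rightarrow> nat \<Rightarrow> 'w \<Rightarrow> real ^ 'd ^ 'n" where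
  "neighbor_noise C \<zeta> k \<omega> = (\<chi> i. \<Sum>j\<in>in_neighbors C i. \<zeta> j k \<omega>)"

text \<open>An \<open>n \<times> d\<close> matrix is a vector of rows, so the library norm on \<open>real ^ 'd ^ 'n\<close> combines the
  row norms; it agrees with the Frobenius norm computed from the columns.\<close>

lemma norm_matrix_eq_columns:
  fixes A :: "real ^ 'd ^ 'n"
  shows "norm A = sqrt (\<Sum>j\<in>UNIV. (norm (column j A))\<^sup>2)"
proof -
  have "(\<Sum>i\<in>UNIV. (norm (A $ i))\<^sup>2) = (\<Sum>i\<in>UNIV. \<Sum>j\<in>UNIV. (A $ i $ j)\<^sup>2)"
    by (simp add: norm_vec_def L2_set_def sum_nonneg)
  also have "\<dots> = (\<Sum>j\<in>UNIV. \<Sum>i\<in>UNIV. (A $ i $ j)\<^sup>2)"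
    by (rule sum.swap)
  also have "\<dots> = (\<Sum>j\<in>UNIV. (norm (column j A))\<^sup>2)"
    by (simp add: norm_vec_def L2_set_def sum_nonneg column_def)
  finally show ?thesis
    by (simp add: norm_vec_def[of A] L2_set_def)
qed

text \<open>The mean square \<open>E[\<parallel>X\<parallel>\<^sup>2]\<close> takes the value \<open>\<infinity>\<close> when \<open>X\<close> is not square integrable.
  A Bochner integral would be \<open>0\<close> in that case.\<close>

definition mean_square :: "'w measure \<Rightarrow> ('w \<Rightarrow> 'b::real_normed_vector) \<Rightarrow> ennreal" where
  "mean_square M X = (\<integral>\<^sup>+ \<omega>. ennreal ((norm (X \<omega>))\<^sup>2) \<partial>M)"

text \<open>The library predicate \<open>indep_var\<close> requires both variables to have the same value type.
  This is its characterization \<open>indep_var_eq\<close>, with the two value types allowed to differ.\<close>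

definition indep_rv ::
  "'w measure \<Rightarrow> 'b measure \<Rightarrow> ('w \<Rightarrow> 'b) \<Rightarrow> 'c measure \<Rightarrow> ('w \<Rightarrow> 'c) \<Rightarrow> bool" where
  "indep_rv M S X T Y \<longleftrightarrow>
    X \<in> measurable M S \<and> Y \<in> measurable M T \<and>
    prob_space.indep_set M
      (sigma_sets (space M) {X -` A \<inter> space M | A. A \<in> sets S})
      (sigma_sets (space M) {Y -` B \<inter> space M | B. B \<in> sets T})"

lemma indep_rv_eq_indep_var:
  assumes "prob_space M"
  shows "indep_rv M S X T Y \<longleftrightarrow> prob_space.indep_var M S X T Y"
  unfolding indep_rv_def prob_space.indep_var_eq[OF assms] by simp

end

theory Submission
  imports Defs "HOL-Real_Asymp.Real_Asymp"
begin

text \<open>The tracking error \<open>e\<^sub>k = z\<^sub>k - C s\<^sub>k\<close> satisfies the recursion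
  \<open>e\<^bsub>k+1\<^esub> = (1 - \<eta>\<^sub>k) e\<^sub>k + \<eta>\<^sub>k \<zeta>\<^sup>C\<^bsub>k+1\<^esub>\<close>, from which \<open>s\<close> has disappeared. The noises of different agents need not be
  independent of each other or of \<open>z\<^sub>1\<close>, so the linear recursion is split by superposition into
  \<open>(\<Prod>t<k. 1 - \<eta>\<^sub>t) e\<^sub>1\<close> and one scalar recursion, started at \<open>0\<close>, for each agent and coordinate.
  Each scalar recursion is driven by independent centred variables \<open>X\<^sub>k\<close>, so its second moments
  \<open>m\<^sub>k\<close> obey \<open>m\<^bsub>k+1\<^esub> \<le> (1 - \<eta>\<^sub>k) m\<^sub>k + \<eta>\<^sub>k\<^sup>2 E X\<^sub>k\<^sup>2\<close>. Summing this gives the weighted summability;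
  comparing it with \<open>c \<eta>\<^sub>k\<close>, using \<open>\<eta>\<^sub>k - \<eta>\<^bsub>k+1\<^esub> \<le> q \<eta>\<^sub>k\<^sup>2\<close> for some \<open>q < 1\<close> and all large \<open>k\<close>, gives the rate.
  Almost sure convergence follows from that of \<open>\<Sum>k. \<eta>\<^sub>k X\<^sub>k\<close> (Kolmogorov), since the relaxation forgets
  a perturbation whose series converges.\<close>

section \<open>Deterministic relaxation recursions\<close>

text \<open>Rewritten as \<open>a k * u k \<le> u k - u (Suc k) + b k\<close>, the step telescopes,
  so the partial sums stay below \<open>u 0 + suminf b\<close>.\<close>

lemma summable_weighted_of_contraction:
  fixes a u b :: "nat \<Rightarrow> real"
  assumes nonneg: "\<And>k. 0 \<le> a k" "\<And>k. 0 \<le> u k" "\<And>k. 0 \<le> b k"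
    and step: "\<And>k. u (Suc k) \<le> (1 - a k) * u k + b k"
    and b: "summable b"
  shows "summable (\<lambda>k. a k * u k)"
proof (rule summableI_nonneg_bounded)
  show "0 \<le> a k * u k" for k
    using nonneg by simp
  have tele: "(\<Sum>k<n. a k * u k) + u n \<le> u 0 + (\<Sum>k<n. b k)" for n
  proof (induction n)
    case (Suc n)
    then show ?case
      using step[of n] by (simp add: algebra_simps)
  qed simp
  show "(\<Sum>k<n. a k * u k) \<le> u 0 + suminf b" for n
    using tele[of n] nonneg(2)[of n] sum_le_suminf[OF b, of "{..<n}"] nonneg(3) by force
qed

text \<open>The sequence decreases, and a positive lower bound \<open>r\<close> would make
  \<open>r * a k\<close> summable by comparison with \<open>a k * u k\<close>, against the
  divergence of \<open>a\<close>.\<close>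

lemma tendsto_zero_of_contraction:
  fixes a u :: "nat \<Rightarrow> real"
  assumes a: "\<And>k. 0 \<le> a k" and div: "\<not> summable a"
    and u: "\<And>k. 0 \<le> u k" and step: "\<And>k. u (Suc k) \<le> (1 - a k) * u k"
  shows "u \<longlonglongrightarrow> 0"
proof -
  have sum: "summable (\<lambda>k. a k * u k)"
    by (rule summable_weighted_of_contraction[where b = "\<lambda>_. 0"]) (use a u step in auto)
  have dec: "decseq u"
  proof (rule decseq_SucI)
    show "u (Suc k) \<le> u k" for k
      using step[of k] mult_nonneg_nonneg[OF a u, of k k] by (simp add: algebra_simps)
  qed
  show ?thesis
  proof (rule LIMSEQ_I)
    fix r :: real assume r: "0 < r"
    have "\<exists>k. u k < r"
    proof (rule ccontr)
      assume "\<not> (\<exists>k. u k < r)"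
      then have "r * a k \<le> a k * u k" for k
        using a by (metis linorder_not_less mult.commute mult_left_mono)
      then have "summable (\<lambda>k. r * a k)"
        by (intro summable_comparison_test'[OF sum, of 0]) (use a r in auto)
      then show False
        using div r by simp
    qed
    then obtain k where "u k < r" by blast
    then have "norm (u n - 0) < r" if "n \<ge> k" for n
      using decseqD[OF dec that] u[of n] by simp
    then show "\<exists>no. \<forall>n\<ge>no. norm (u n - 0) < r" by blast
  qed
qed

lemma tendsto_zero_of_relaxation:
  fixes a x d :: "nat \<Rightarrow> real"
  assumes a: "\<And>k. 0 \<le> a k" "\<And>k. a k \<le> 1" and div: "\<not> summable a"
    and d: "summable d" and step: "\<And>k. x (Suc k) = (1 - a k) * x k + d k"
  shows "x \<longlonglongrightarrow> 0"
proof -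
  \<comment> \<open>Subtracting the tail of the series from \<open>x\<close> turns the merely summable perturbation
    \<open>d\<close> into one of size \<open>a k * R k\<close> with \<open>R\<close> tending to zero.\<close>
  define R where "R k = (\<Sum>i<k. d i) - suminf d" for k
  define y where "y k = x k - R k" for k
  have R: "R \<longlonglongrightarrow> 0"
    unfolding R_def using tendsto_diff[OF summable_LIMSEQ[OF d] tendsto_const[of "suminf d"]] by simp
  have y_step: "y (Suc k) = (1 - a k) * y k - a k * R k" for k
    by (simp add: y_def R_def step algebra_simps)
  have "y \<longlonglongrightarrow> 0"
  proof (rule LIMSEQ_I)
    fix r :: real assume r: "0 < r"
    obtain K where K: "\<And>k. k \<ge> K \<Longrightarrow> \<bar>R k\<bar> < r / 2"
      using LIMSEQ_D[OF R, of "r / 2"] r by auto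
    \<comment> \<open>Past \<open>K\<close> the level \<open>r / 2\<close> bounds
      \<open>\<bar>R k\<bar>\<close>, so the excess of \<open>\<bar>y\<bar>\<close> over this level
      obeys a contraction without forcing. The truncation at 0 keeps it nonnegative.\<close>
    define u where "u k = max (\<bar>y (K + k)\<bar> - r / 2) 0" for k
    have "u \<longlonglongrightarrow> 0"
    proof (rule tendsto_zero_of_contraction[of "\<lambda>k. a (K + k)"])
      show "\<not> summable (\<lambda>k. a (K + k))"
        using div summable_iff_shift[of a K] by (simp add: add.commute)
      show "u (Suc k) \<le> (1 - a (K + k)) * u k" for k
      proof -
        have "\<bar>y (K + Suc k)\<bar> \<le> \<bar>(1 - a (K + k)) * y (K + k)\<bar> + \<bar>a (K + k) * R (K + k)\<bar>"
          using y_step[of "K + k"] by simp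
        also have "\<dots> = (1 - a (K + k)) * \<bar>y (K + k)\<bar> + a (K + k) * \<bar>R (K + k)\<bar>"
          using a[of "K + k"] by (simp add: abs_mult)
        also have "\<dots> \<le> (1 - a (K + k)) * \<bar>y (K + k)\<bar> + a (K + k) * (r / 2)"
          using K[of "K + k"] a[of "K + k"] by (intro add_left_mono mult_left_mono) auto
        finally have "\<bar>y (K + Suc k)\<bar> - r / 2 \<le> (1 - a (K + k)) * (\<bar>y (K + k)\<bar> - r / 2)"
          by (simp add: algebra_simps)
        also have "\<dots> \<le> (1 - a (K + k)) * u k"
          using a[of "K + k"] by (intro mult_left_mono) (auto simp: u_def)
        finally show ?thesis
          using a[of "K + k"] by (simp add: u_def)
      qed
    qed (use a in \<open>auto simp: u_def\<close>)
    then obtain N where N: "\<And>k. k \<ge> N \<Longrightarrow> u k < r / 2"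
      using LIMSEQ_D[of u 0 "r / 2"] r by (fastforce simp: u_def)
    have "norm (y n - 0) < r" if n: "n \<ge> K + N" for n
    proof -
      have "u (n - K) < r / 2"
        using N n by simp
      moreover have "\<bar>y n\<bar> - r / 2 \<le> u (n - K)"
        using n by (simp add: u_def)
      ultimately show ?thesis by simp
    qed
    then show "\<exists>no. \<forall>n\<ge>no. norm (y n - 0) < r" by blast
  qed
  then show ?thesis
    using tendsto_add[OF _ R, of y 0] by (simp add: y_def)
qed

text \<open>Inserting \<open>v k \<le> c * a k\<close> and \<open>S \<le> c * (1 - q)\<close> into
  the step gives \<open>c * (a k - q * (a k)\<^sup>2)\<close>, which \<open>slow\<close> bounds by
  \<open>c * a (Suc k)\<close>. The gap \<open>1 - q\<close> is what absorbs the forcing.\<close>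

lemma bounded_by_stepsize:
  fixes a v :: "nat \<Rightarrow> real"
  assumes a: "\<And>k. 0 < a k" "\<And>k. a k \<le> 1" and q: "q < 1"
    and slow: "\<And>k. k \<ge> K \<Longrightarrow> a k - a (Suc k) \<le> q * (a k)\<^sup>2"
    and step: "\<And>k. v (Suc k) \<le> (1 - a k) * v k + (a k)\<^sup>2 * S"
  shows "\<exists>c>0. \<forall>k. v k \<le> c * a k"
proof -
  \<comment> \<open>The entry 1 makes \<open>c\<close> positive, \<open>S / (1 - q)\<close> drives
    the induction, and the quotients settle the finitely many indices up to \<open>K\<close>, where
    the induction starts.\<close>
  define c where "c = Max (insert 1 (insert (S / (1 - q)) ((\<lambda>k. v k / a k) ` {..K})))"
  have c1: "1 \<le> c" and cS: "S / (1 - q) \<le> c"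
    by (simp_all add: c_def)
  have init: "v k \<le> c * a k" if "k \<le> K" for k
  proof -
    have "v k / a k \<le> c"
      unfolding c_def using that by (intro Max_ge) auto
    then show ?thesis
      using a[of k] by (simp add: field_simps)
  qed
  have main: "v (K + k) \<le> c * a (K + k)" for k
  proof (induction k)
    case (Suc k)
    let ?n = "K + k"
    have S: "S \<le> c * (1 - q)"
      using cS q by (simp add: field_simps)
    have "v (Suc ?n) \<le> (1 - a ?n) * (c * a ?n) + (a ?n)\<^sup>2 * (c * (1 - q))"
      by (rule order_trans[OF step[of ?n]]) (use a[of ?n] Suc.IH S in \<open>auto intro!: add_mono mult_left_mono\<close>)
    also have "\<dots> = c * (a ?n - q * (a ?n)\<^sup>2)"
      by (simp add: algebra_simps power2_eq_square)
    also have "\<dots> \<le> c * a (Suc ?n)"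
      using slow[of ?n] c1 by (intro mult_left_mono) auto
    finally show ?case by simp
  qed (use init in simp)
  have "v k \<le> c * a k" for k
    using init[of k] main[of "k - K"] by (cases "k \<le> K") auto
  with c1 show ?thesis by (intro exI[of _ c]) auto
qed

text \<open>The difference has order \<open>k powr (- p - 1)\<close>, the square order
  \<open>k powr (- 2 * p)\<close>, which dominates because \<open>p < 1\<close>. Any positive factor
  in place of 1/2 would do.\<close>

lemma power_stepsize_slow:
  fixes \<eta>\<^sub>0 p :: real
  assumes "0 < \<eta>\<^sub>0" "0 < p" "p < 1"
  shows "eventually (\<lambda>k::nat. \<eta>\<^sub>0 / real (Suc k) powr p - \<eta>\<^sub>0 / real (Suc (Suc k)) powr p
           \<le> 1/2 * (\<eta>\<^sub>0 / real (Suc k) powr p)\<^sup>2) at_top"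
  using assms by real_asymp

text \<open>The difference divided by the square is
  \<open>(k + 2) / ((k + 3) * \<eta>\<^sub>0)\<close>. The assumption
  \<open>1 < \<eta>\<^sub>0\<close> puts \<open>1 / \<eta>\<^sub>0\<close> below 1, as
  \<open>bounded_by_stepsize\<close> requires of \<open>q\<close>.\<close>

lemma harmonic_stepsize_slow:
  fixes \<eta>\<^sub>0 :: real
  assumes "1 < \<eta>\<^sub>0"
  shows "\<eta>\<^sub>0 / (real (Suc k) + 1) - \<eta>\<^sub>0 / (real (Suc (Suc k)) + 1)
           \<le> (1 / \<eta>\<^sub>0) * (\<eta>\<^sub>0 / (real (Suc k) + 1))\<^sup>2"
proof -
  have "\<eta>\<^sub>0 / (real (Suc k) + 1) - \<eta>\<^sub>0 / (real (Suc (Suc k)) + 1)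
      = \<eta>\<^sub>0 / ((real k + 2) * (real k + 3))"
    by (simp add: divide_simps) (simp add: algebra_simps)
  also have "\<dots> \<le> \<eta>\<^sub>0 / ((real k + 2) * (real k + 2))"
    using assms by (intro divide_left_mono mult_left_mono) auto
  also have "\<dots> = (1 / \<eta>\<^sub>0) * (\<eta>\<^sub>0 / (real (Suc k) + 1))\<^sup>2"
    using assms by (simp add: power2_eq_square divide_simps) (simp add: algebra_simps)
  finally show ?thesis .
qed

section \<open>Recursions driven by independent noise\<close>

text \<open>One scheme for two processes: the linear relaxation and the random walk stopped at an
  exit. The value at time \<open>k\<close> uses only \<open>x i\<close> with \<open>i < k\<close>,
  hence is independent of \<open>x k\<close> for independent inputs.\<close>

primrec driven :: "(nat \<Rightarrow> real \<Rightarrow> real) \<Rightarrow> (nat \<Rightarrow> real \<Rightarrow> real) \<Rightarrow> (nat \<Rightarrow> real) \<Rightarrow> nat \<Rightarrow> real" where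
  "driven f g x 0 = 0"
| "driven f g x (Suc k) = f k (driven f g x k) + g k (driven f g x k) * x k"

lemma driven_cong:
  "(\<And>i. i < k \<Longrightarrow> x i = y i) \<Longrightarrow> driven f g x k = driven f g y k"
  by (induction k) auto

lemma measurable_driven_PiM:
  assumes "\<And>k. f k \<in> borel_measurable borel" "\<And>k. g k \<in> borel_measurable borel" "k \<le> n"
  shows "(\<lambda>x. driven f g x k) \<in> borel_measurable (PiM {..<n} (\<lambda>_. borel))"
  using assms(3)
proof (induction k)
  case (Suc k)
  have [measurable]: "f k \<in> borel_measurable borel" "g k \<in> borel_measurable borel"
    using assms by auto
  have [measurable]: "(\<lambda>x. driven f g x k) \<in> borel_measurable (PiM {..<n} (\<lambda>_. borel))"
    using Suc by simp
  have [measurable]: "(\<lambda>x. x k) \<in> borel_measurable (PiM {..<n} (\<lambda>_. borel :: real measure))"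
    using Suc.prems by (intro measurable_component_singleton) auto
  show ?case by simp
qed simp

context prob_space
begin

lemma indep_vars_reindex:
  assumes indep: "indep_vars M' X (h ` I)" and h: "inj_on h I"
  shows "indep_vars (\<lambda>i. M' (h i)) (\<lambda>i. X (h i)) I"
proof -
  let ?F = "\<lambda>i. {X i -` A \<inter> space M |A. A \<in> sets (M' i)}"
  have F: "indep_sets ?F (h ` I)"
    using indep by (simp add: indep_vars_def2)
  have "indep_sets (\<lambda>i. ?F (h i)) I"
  proof (rule indep_setsI)
    show "?F (h i) \<subseteq> events" if "i \<in> I" for i
      using F that unfolding indep_sets_def by blast
    fix A J assume J: "J \<noteq> {}" "J \<subseteq> I" "finite J" and A: "\<forall>j\<in>J. A j \<in> ?F (h j)"
    have inj: "inj_on h J"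
      using h J inj_on_subset by blast
    \<comment> \<open>The events are carried from \<open>J\<close> to its image under
      \<open>h\<close>, where the given independence applies; injectivity turns the product over the
      image back into one over \<open>J\<close>.\<close>
    let ?B = "\<lambda>k. A (the_inv_into J h k)"
    have B: "?B (h j) = A j" if "j \<in> J" for j
      using the_inv_into_f_f[OF inj that] by simp
    have "prob (\<Inter>k\<in>h ` J. ?B k) = (\<Prod>k\<in>h ` J. prob (?B k))"
    proof (rule indep_setsD[OF F])
      show "\<forall>k\<in>h ` J. ?B k \<in> ?F k"
        using A by (simp add: B)
    qed (use J in auto)
    then show "prob (\<Inter>j\<in>J. A j) = (\<Prod>j\<in>J. prob (A j))"
      by (simp add: prod.reindex[OF inj] B)
  qed
  then show ?thesis
    using indep by (auto simp: indep_vars_def2)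
qed

text \<open>The state at time \<open>k\<close> is a measurable function of the inputs in
  \<open>{..<k}\<close>, a block disjoint from \<open>{k}\<close>.\<close>

lemma indep_var_driven:
  fixes X :: "nat \<Rightarrow> 'a \<Rightarrow> real"
  assumes "indep_vars (\<lambda>_. borel) X UNIV"
    and "\<And>k. f k \<in> borel_measurable borel" "\<And>k. g k \<in> borel_measurable borel"
  shows "indep_var borel (\<lambda>\<omega>. driven f g (\<lambda>i. X i \<omega>) k) borel (X k)"
proof -
  have "indep_var borel ((\<lambda>x. driven f g x k) \<circ> (\<lambda>\<omega>. restrict (\<lambda>i. X i \<omega>) {..<k}))
          borel ((\<lambda>x. x k) \<circ> (\<lambda>\<omega>. restrict (\<lambda>i. X i \<omega>) {k}))"
    using assms
    by (intro indep_var_compose[OF indep_var_restrict[OF assms(1)]] measurable_driven_PiM) auto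
  moreover have "(\<lambda>x. driven f g x k) \<circ> (\<lambda>\<omega>. restrict (\<lambda>i. X i \<omega>) {..<k})
      = (\<lambda>\<omega>. driven f g (\<lambda>i. X i \<omega>) k)"
    by (auto simp: fun_eq_iff intro!: driven_cong)
  moreover have "(\<lambda>x. x k) \<circ> (\<lambda>\<omega>. restrict (\<lambda>i. X i \<omega>) {k}) = X k"
    by auto
  ultimately show ?thesis by simp
qed

text \<open>Expanding the square leaves a cross term of mean zero: its factor
  \<open>f k (Y k) * g k (Y k)\<close> depends on the past only, so it is independent of the centred
  \<open>X k\<close>. Nonlinear \<open>g\<close> is allowed, as the stopped walk requires.\<close>

lemma driven_second_moment:
  fixes X :: "nat \<Rightarrow> 'a \<Rightarrow> real"
  assumes indep: "indep_vars (\<lambda>_. borel) X UNIV"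
    and X_sq: "\<And>k. integrable M (\<lambda>\<omega>. (X k \<omega>)\<^sup>2)" and X_mean: "\<And>k. expectation (X k) = 0"
    and f: "\<And>k. f k \<in> borel_measurable borel" and g: "\<And>k. g k \<in> borel_measurable borel"
    and f_le: "\<And>k y. \<bar>f k y\<bar> \<le> r k * \<bar>y\<bar>" and g_le: "\<And>k y. \<bar>g k y\<bar> \<le> b k"
  defines "Y k \<omega> \<equiv> driven f g (\<lambda>i. X i \<omega>) k"
  shows "integrable M (\<lambda>\<omega>. (Y k \<omega>)\<^sup>2)"
    and "expectation (\<lambda>\<omega>. (Y (Suc k) \<omega>)\<^sup>2)
      \<le> (r k)\<^sup>2 * expectation (\<lambda>\<omega>. (Y k \<omega>)\<^sup>2) + (b k)\<^sup>2 * expectation (\<lambda>\<omega>. (X k \<omega>)\<^sup>2)"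
proof -
  have X_rv [measurable]: "X k \<in> borel_measurable M" for k
    using indep by (auto simp: indep_vars_def)
  have X_int: "integrable M (X k)" for k
    by (rule square_integrable_imp_integrable[OF X_rv X_sq])
  have iv: "indep_var borel (Y k) borel (X k)" for k
    unfolding Y_def by (rule indep_var_driven[OF indep f g])
  have Y_rv [measurable]: "Y k \<in> borel_measurable M" for k
    using indep_var_rv1[OF iv] by simp
  have [measurable]: "(\<lambda>\<omega>. f k (Y k \<omega>)) \<in> borel_measurable M"
      "(\<lambda>\<omega>. g k (Y k \<omega>)) \<in> borel_measurable M" for k
    by (rule measurable_compose[OF Y_rv f], rule measurable_compose[OF Y_rv g])
  have step: "integrable M (\<lambda>\<omega>. (Y (Suc k) \<omega>)\<^sup>2) \<and> expectation (\<lambda>\<omega>. (Y (Suc k) \<omega>)\<^sup>2)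
      \<le> (r k)\<^sup>2 * expectation (\<lambda>\<omega>. (Y k \<omega>)\<^sup>2) + (b k)\<^sup>2 * expectation (\<lambda>\<omega>. (X k \<omega>)\<^sup>2)"
    if Y_sq: "integrable M (\<lambda>\<omega>. (Y k \<omega>)\<^sup>2)" for k
  proof -
    let ?F = "\<lambda>\<omega>. (f k (Y k \<omega>))\<^sup>2" and ?G = "\<lambda>\<omega>. (g k (Y k \<omega>) * X k \<omega>)\<^sup>2"
    let ?H = "\<lambda>\<omega>. 2 * (f k (Y k \<omega>) * g k (Y k \<omega>) * X k \<omega>)"
    have F_le: "?F \<omega> \<le> (r k)\<^sup>2 * (Y k \<omega>)\<^sup>2" for \<omega>
      using power_mono[OF f_le abs_ge_zero, of k "Y k \<omega>" 2] by (simp add: power_mult_distrib)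
    have g2: "(g k y)\<^sup>2 \<le> (b k)\<^sup>2" for y
      using power_mono[OF g_le abs_ge_zero, of k y 2] by simp
    have G_le: "?G \<omega> \<le> (b k)\<^sup>2 * (X k \<omega>)\<^sup>2" for \<omega>
      using g2 by (simp add: power_mult_distrib mult_right_mono)
    have F: "integrable M ?F"
      by (rule Bochner_Integration.integrable_bound[of M "\<lambda>\<omega>. (r k)\<^sup>2 * (Y k \<omega>)\<^sup>2"])
         (use F_le Y_sq in auto)
    have G: "integrable M ?G"
      by (rule Bochner_Integration.integrable_bound[of M "\<lambda>\<omega>. (b k)\<^sup>2 * (X k \<omega>)\<^sup>2"])
         (use G_le X_sq in auto)
    have Y_int: "integrable M (Y k)"
      by (rule square_integrable_imp_integrable[OF Y_rv Y_sq])
    \<comment> \<open>The factor is bounded linearly in \<open>Y k\<close>, so it is integrable;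
      independence, rather than Cauchy-Schwarz, then yields integrability of the cross term.\<close>
    have fg_int: "integrable M (\<lambda>\<omega>. f k (Y k \<omega>) * g k (Y k \<omega>))"
    proof (rule Bochner_Integration.integrable_bound[of M "\<lambda>\<omega>. r k * b k * \<bar>Y k \<omega>\<bar>"])
      show "integrable M (\<lambda>\<omega>. r k * b k * \<bar>Y k \<omega>\<bar>)"
        using Y_int by simp
      have "\<bar>f k y * g k y\<bar> \<le> r k * b k * \<bar>y\<bar>" for y
        using mult_mono[OF f_le g_le _ abs_ge_zero, of k y k y] order_trans[OF abs_ge_zero f_le, of k y]
        by (simp add: abs_mult mult_ac)
      then have "\<bar>f k y * g k y\<bar> \<le> \<bar>r k * b k * \<bar>y\<bar>\<bar>" for y
        by (rule order_trans[OF _ abs_ge_self])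
      then show "AE \<omega> in M. norm (f k (Y k \<omega>) * g k (Y k \<omega>)) \<le> norm (r k * b k * \<bar>Y k \<omega>\<bar>)"
        unfolding real_norm_def by (rule AE_I2)
    qed simp
    have iv_fg: "indep_var borel (\<lambda>\<omega>. f k (Y k \<omega>) * g k (Y k \<omega>)) borel (X k)"
      using indep_var_compose[OF iv borel_measurable_times[OF f g] measurable_ident]
      by (simp add: o_def id_def)
    have H: "integrable M ?H"
      using indep_var_integrable[OF iv_fg fg_int X_int] by simp
    have H0: "expectation ?H = 0"
      using indep_var_lebesgue_integral[OF iv_fg fg_int X_int] X_mean by simp
    have eq: "(Y (Suc k) \<omega>)\<^sup>2 = ?F \<omega> + ?G \<omega> + ?H \<omega>" for \<omega>
      by (simp add: Y_def power2_sum)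
    have "expectation (\<lambda>\<omega>. (Y (Suc k) \<omega>)\<^sup>2) = expectation ?F + expectation ?G"
      unfolding eq using F G H H0 by simp
    also have "\<dots> \<le> expectation (\<lambda>\<omega>. (r k)\<^sup>2 * (Y k \<omega>)\<^sup>2) + expectation (\<lambda>\<omega>. (b k)\<^sup>2 * (X k \<omega>)\<^sup>2)"
      using F G Y_sq X_sq F_le G_le by (intro add_mono integral_mono) auto
    finally show ?thesis
      unfolding eq using F G H by simp
  qed
  show Y_sq: "integrable M (\<lambda>\<omega>. (Y k \<omega>)\<^sup>2)" for k
    by (induction k) (use step in \<open>auto simp: Y_def simp del: driven.simps(2)\<close>)
  show "expectation (\<lambda>\<omega>. (Y (Suc k) \<omega>)\<^sup>2)
      \<le> (r k)\<^sup>2 * expectation (\<lambda>\<omega>. (Y k \<omega>)\<^sup>2) + (b k)\<^sup>2 * expectation (\<lambda>\<omega>. (X k \<omega>)\<^sup>2)"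
    using step[OF Y_sq] by blast
qed

text \<open>The process stopped at its first exit from \<open>(-\<epsilon>, \<epsilon>)\<close> is again of the form
  \<^const>\<open>driven\<close>, so its second moment is controlled by that of the increments.\<close>

lemma kolmogorov_maximal_inequality:
  fixes X :: "nat \<Rightarrow> 'a \<Rightarrow> real"
  assumes indep: "indep_vars (\<lambda>_. borel) X UNIV"
    and X_sq: "\<And>k. integrable M (\<lambda>\<omega>. (X k \<omega>)\<^sup>2)" and X_mean: "\<And>k. expectation (X k) = 0"
    and \<epsilon>: "0 < \<epsilon>"
  shows "prob {\<omega>\<in>space M. \<exists>k\<le>n. \<epsilon> \<le> \<bar>\<Sum>i<k. X i \<omega>\<bar>}
    \<le> (\<Sum>i<n. expectation (\<lambda>\<omega>. (X i \<omega>)\<^sup>2)) / \<epsilon>\<^sup>2"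
proof -
  define f :: "nat \<Rightarrow> real \<Rightarrow> real" where "f k y = y" for k y
  define g :: "nat \<Rightarrow> real \<Rightarrow> real" where "g k y = (if \<epsilon> \<le> \<bar>y\<bar> then 0 else 1)" for k y
  define T where "T k \<omega> = driven f g (\<lambda>i. X i \<omega>) k" for k \<omega>
  have X_rv [measurable]: "X k \<in> borel_measurable M" for k
    using indep by (auto simp: indep_vars_def)
  have f: "f k \<in> borel_measurable borel" and g: "g k \<in> borel_measurable borel" for k
    unfolding f_def[abs_def] g_def[abs_def] by measurable
  have T_sq: "integrable M (\<lambda>\<omega>. (T k \<omega>)\<^sup>2)" for k
    unfolding T_def
    by (rule driven_second_moment(1)[OF indep X_sq X_mean f g, where r = "\<lambda>_. 1" and b = "\<lambda>_. 1"])
       (auto simp: f_def g_def)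
  have T_step: "expectation (\<lambda>\<omega>. (T (Suc k) \<omega>)\<^sup>2)
      \<le> 1\<^sup>2 * expectation (\<lambda>\<omega>. (T k \<omega>)\<^sup>2) + 1\<^sup>2 * expectation (\<lambda>\<omega>. (X k \<omega>)\<^sup>2)" for k
    unfolding T_def
    by (rule driven_second_moment(2)[OF indep X_sq X_mean f g, where r = "\<lambda>_. 1" and b = "\<lambda>_. 1"])
       (auto simp: f_def g_def)
  have T_le: "expectation (\<lambda>\<omega>. (T n \<omega>)\<^sup>2) \<le> (\<Sum>i<n. expectation (\<lambda>\<omega>. (X i \<omega>)\<^sup>2))" for n
  proof (induction n)
    case (Suc n)
    then show ?case using T_step[of n] by simp
  qed (simp add: T_def)
  have T_rv [measurable]: "T k \<in> borel_measurable M" for k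
    unfolding T_def by (rule indep_var_rv1[OF indep_var_driven[OF indep f g]])
  have T_sum: "T k \<omega> = (\<Sum>i<k. X i \<omega>)" if "\<And>j. j < k \<Longrightarrow> \<bar>\<Sum>i<j. X i \<omega>\<bar> < \<epsilon>" for k \<omega>
    using that
  proof (induction k)
    case (Suc k)
    then have "T k \<omega> = (\<Sum>i<k. X i \<omega>)" "\<bar>\<Sum>i<k. X i \<omega>\<bar> < \<epsilon>" by auto
    then show ?case by (simp add: T_def f_def g_def)
  qed (simp add: T_def)
  \<comment> \<open>Outside the interval \<open>g\<close> vanishes and \<open>f\<close> is the
    identity, so the process is frozen.\<close>
  have stay: "\<epsilon> \<le> \<bar>T (k + j) \<omega>\<bar>" if "\<epsilon> \<le> \<bar>T k \<omega>\<bar>" for k j \<omega>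
    by (induction j) (use that in \<open>auto simp: T_def f_def g_def\<close>)
  have exit: "\<epsilon> \<le> \<bar>T n \<omega>\<bar>" if "k \<le> n" "\<epsilon> \<le> \<bar>\<Sum>i<k. X i \<omega>\<bar>" for k \<omega>
  proof -
    \<comment> \<open>\<open>m\<close> is the first exit time. Up to it \<open>T\<close> agrees with
      the partial sums, and afterwards it keeps the value reached, so an exit by time
      \<open>n\<close> is still visible in \<open>T n\<close>.\<close>
    define m where "m = (LEAST k. \<epsilon> \<le> \<bar>\<Sum>i<k. X i \<omega>\<bar>)"
    have m: "\<epsilon> \<le> \<bar>\<Sum>i<m. X i \<omega>\<bar>" "m \<le> k"
      unfolding m_def using that(2) by (auto intro: LeastI Least_le)
    have "\<bar>\<Sum>i<j. X i \<omega>\<bar> < \<epsilon>" if "j < m" for j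
      using not_less_Least[OF that[unfolded m_def]] by simp
    then have "\<epsilon> \<le> \<bar>T m \<omega>\<bar>"
      using T_sum m(1) by simp
    from stay[OF this, of "n - m"] show ?thesis
      using m(2) that(1) by simp
  qed
  have "prob {\<omega>\<in>space M. \<exists>k\<le>n. \<epsilon> \<le> \<bar>\<Sum>i<k. X i \<omega>\<bar>} \<le> prob {\<omega>\<in>space M. \<epsilon> \<le> \<bar>T n \<omega>\<bar>}"
    using exit by (intro finite_measure_mono) auto
  also have "\<dots> \<le> expectation (\<lambda>\<omega>. (T n \<omega>)\<^sup>2) / \<epsilon>\<^sup>2"
    by (rule second_moment_method[OF T_rv T_sq \<epsilon>])
  also have "\<dots> \<le> (\<Sum>i<n. expectation (\<lambda>\<omega>. (X i \<omega>)\<^sup>2)) / \<epsilon>\<^sup>2"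
    using T_le \<epsilon> by (intro divide_right_mono) auto
  finally show ?thesis .
qed

text \<open>The maximal inequality applied beyond index \<open>m\<close> bounds the probability of a
  later oscillation by the tail of the variance series; letting \<open>m\<close> grow makes almost
  every path Cauchy.\<close>

lemma kolmogorov_one_series:
  fixes X :: "nat \<Rightarrow> 'a \<Rightarrow> real"
  assumes indep: "indep_vars (\<lambda>_. borel) X UNIV"
    and X_sq: "\<And>k. integrable M (\<lambda>\<omega>. (X k \<omega>)\<^sup>2)" and X_mean: "\<And>k. expectation (X k) = 0"
    and var: "summable (\<lambda>k. expectation (\<lambda>\<omega>. (X k \<omega>)\<^sup>2))"
  shows "AE \<omega> in M. summable (\<lambda>k. X k \<omega>)"
proof -
  define v where "v k = expectation (\<lambda>\<omega>. (X k \<omega>)\<^sup>2)" for k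
  have v_nonneg: "0 \<le> v k" for k
    by (simp add: v_def)
  have X_rv [measurable]: "X k \<in> borel_measurable M" for k
    using indep by (auto simp: indep_vars_def)
  define E where "E m \<epsilon> = {\<omega>\<in>space M. \<exists>k. \<epsilon> \<le> \<bar>\<Sum>i<k. X (i + m) \<omega>\<bar>}" for m \<epsilon>
  have E_meas [measurable]: "E m \<epsilon> \<in> events" for m \<epsilon>
    unfolding E_def by measurable
  have E_le: "prob (E m \<epsilon>) \<le> (\<Sum>i. v (i + m)) / \<epsilon>\<^sup>2" if \<epsilon>: "0 < \<epsilon>" for m \<epsilon>
  proof -
    \<comment> \<open>The maximal inequality has a finite horizon. As \<open>D n\<close> increases
      to \<open>E m \<epsilon>\<close>, continuity from below removes it.\<close>
    define D where "D n = {\<omega>\<in>space M. \<exists>k\<le>n. \<epsilon> \<le> \<bar>\<Sum>i<k. X (i + m) \<omega>\<bar>}" for n :: nat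
    have "(\<lambda>n. prob (D n)) \<longlonglongrightarrow> prob (\<Union>n. D n)"
      by (rule finite_Lim_measure_incseq)
         (auto simp: D_def incseq_def intro: order_trans)
    moreover have "(\<Union>n. D n) = E m \<epsilon>"
      by (auto simp: D_def E_def)
    moreover have "prob (D n) \<le> (\<Sum>i. v (i + m)) / \<epsilon>\<^sup>2" for n
    proof -
      have "indep_vars (\<lambda>_. borel) (\<lambda>i. X (i + m)) UNIV"
        using indep_vars_subset[OF indep subset_UNIV, of "range (\<lambda>i. i + m)"]
        by (rule indep_vars_reindex) simp
      then have "prob (D n) \<le> (\<Sum>i<n. v (i + m)) / \<epsilon>\<^sup>2"
        unfolding D_def v_def using \<epsilon> X_sq X_mean
        by (intro kolmogorov_maximal_inequality) (auto simp: o_def)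
      also have "\<dots> \<le> (\<Sum>i. v (i + m)) / \<epsilon>\<^sup>2"
        using var v_nonneg
        by (intro divide_right_mono sum_le_suminf) (auto simp: v_def[abs_def, symmetric])
      finally show ?thesis .
    qed
    ultimately show ?thesis
      by (intro LIMSEQ_le_const2) auto
  qed
  have AE_p: "AE \<omega> in M. \<exists>m. \<forall>k. \<bar>\<Sum>i<k. X (i + m) \<omega>\<bar> < \<epsilon>" if \<epsilon>: "0 < \<epsilon>" for \<epsilon>
  proof -
    \<comment> \<open>The intersection lies in every \<open>E m \<epsilon>\<close>, so each variance
      tail bounds its probability, and the tails tend to 0.\<close>
    have "prob (\<Inter>m. E m \<epsilon>) \<le> (\<Sum>i. v (i + m)) / \<epsilon>\<^sup>2" for m
      by (rule order_trans[OF finite_measure_mono E_le[OF \<epsilon>]]) auto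
    moreover have "(\<lambda>m. (\<Sum>i. v (i + m)) / \<epsilon>\<^sup>2) \<longlonglongrightarrow> 0 / \<epsilon>\<^sup>2"
      using suminf_exist_split2[of v] var \<epsilon>
      by (intro tendsto_divide) (auto simp: v_def[abs_def])
    ultimately have "prob (\<Inter>m. E m \<epsilon>) \<le> 0"
      by (intro LIMSEQ_le_const[of _ 0]) auto
    then have "emeasure M (\<Inter>m. E m \<epsilon>) = 0"
      by (simp add: emeasure_eq_measure measure_le_0_iff)
    then have "AE \<omega> in M. \<omega> \<notin> (\<Inter>m. E m \<epsilon>)"
      by (intro AE_not_in) (auto simp: null_sets_def)
    with AE_space show ?thesis
      by eventually_elim (auto simp: E_def not_le)
  qed
  have "AE \<omega> in M. \<forall>p::nat. \<exists>m. \<forall>k. \<bar>\<Sum>i<k. X (i + m) \<omega>\<bar> < 1 / real (Suc p)"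
    unfolding AE_all_countable by (intro allI AE_p) simp
  then show ?thesis
  proof eventually_elim
    case (elim \<omega>)
    show ?case
      unfolding summable_Cauchy
    proof (intro allI impI)
      fix e :: real assume "0 < e"
      \<comment> \<open>Half of \<open>e\<close>, because a block sum is the difference of two sums
        starting at \<open>m\<close>.\<close>
      then obtain p where p: "1 / real (Suc p) < e / 2"
        using nat_approx_posE[of "e / 2"] by auto
      obtain m where m: "\<And>k. \<bar>\<Sum>i<k. X (i + m) \<omega>\<bar> < 1 / real (Suc p)"
        using elim by blast
      have "norm (\<Sum>i\<in>{k..<l}. X i \<omega>) < e" if "k \<ge> m" for k l
      proof (cases "k \<le> l")
        case True
        have shift: "(\<Sum>i<j - m. X (i + m) \<omega>) = (\<Sum>i\<in>{m..<j}. X i \<omega>)" if "m \<le> j" for j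
          using sum.shift_bounds_nat_ivl[of "\<lambda>i. X i \<omega>" 0 m "j - m"] that
          by (simp add: atLeast0LessThan)
        have "(\<Sum>i\<in>{m..<k}. X i \<omega>) + (\<Sum>i\<in>{k..<l}. X i \<omega>) = (\<Sum>i\<in>{m..<l}. X i \<omega>)"
          using True that by (intro sum.atLeastLessThan_concat) auto
        then show ?thesis
          using m[of "k - m"] m[of "l - m"] shift[of k] shift[of l] p True that by simp
      qed (use \<open>0 < e\<close> in simp)
      then show "\<exists>N. \<forall>m\<ge>N. \<forall>n. norm (sum (\<lambda>i. X i \<omega>) {m..<n}) < e"
        by blast
    qed
  qed
qed

end

lemma norm_matrix_sq:
  fixes A :: "real ^ 'd ^ 'n"
  shows "(norm A)\<^sup>2 = (\<Sum>i\<in>UNIV. \<Sum>c\<in>UNIV. (A $ i $ c)\<^sup>2)"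
  by (simp add: norm_vec_def L2_set_def sum_nonneg)

text \<open>By monotone convergence the pointwise sum has finite integral, hence is finite almost
  everywhere.\<close>

lemma AE_summable_of_summable_integral:
  fixes f :: "nat \<Rightarrow> 'a \<Rightarrow> real"
  assumes int: "\<And>k. integrable M (f k)" and nonneg: "\<And>k \<omega>. 0 \<le> f k \<omega>"
    and sum: "summable (\<lambda>k. \<integral>\<omega>. f k \<omega> \<partial>M)"
  shows "AE \<omega> in M. summable (\<lambda>k. f k \<omega>)"
proof -
  have [measurable]: "f k \<in> borel_measurable M" for k
    using int by auto
  have "(\<integral>\<^sup>+\<omega>. (\<Sum>k. ennreal (f k \<omega>)) \<partial>M) = (\<Sum>k. \<integral>\<^sup>+\<omega>. ennreal (f k \<omega>) \<partial>M)"
    by (rule nn_integral_suminf) measurable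
  also have "\<dots> = (\<Sum>k. ennreal (\<integral>\<omega>. f k \<omega> \<partial>M))"
    using int nonneg by (simp add: nn_integral_eq_integral)
  also have "\<dots> \<noteq> \<infinity>"
    using sum nonneg by (simp add: suminf_ennreal2 integral_nonneg_AE)
  finally have "AE \<omega> in M. (\<Sum>k. ennreal (f k \<omega>)) \<noteq> \<infinity>"
    by (intro nn_integral_noteq_infinite) auto
  then show ?thesis
    by eventually_elim (use nonneg in \<open>auto intro: summable_suminf_not_top\<close>)
qed

section \<open>Linear relaxation driven by independent centred noise\<close>

context prob_space
begin

lemma
  fixes X :: "nat \<Rightarrow> 'a \<Rightarrow> real"
  assumes indep: "indep_vars (\<lambda>_. borel) X UNIV"
    and X_sq: "\<And>k. integrable M (\<lambda>\<omega>. (X k \<omega>)\<^sup>2)" and X_mean: "\<And>k. expectation (X k) = 0"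
    and a: "\<And>k. 0 \<le> a k" "\<And>k. a k \<le> 1"
  defines "x k \<omega> \<equiv> driven (\<lambda>k y. (1 - a k) * y) (\<lambda>k _. a k) (\<lambda>i. X i \<omega>) k"
  shows relaxation_square_integrable: "integrable M (\<lambda>\<omega>. (x k \<omega>)\<^sup>2)"
    and relaxation_second_moment: "expectation (\<lambda>\<omega>. (x (Suc k) \<omega>)\<^sup>2)
      \<le> (1 - a k) * expectation (\<lambda>\<omega>. (x k \<omega>)\<^sup>2) + (a k)\<^sup>2 * expectation (\<lambda>\<omega>. (X k \<omega>)\<^sup>2)"
    and relaxation_tendsto_zero: "\<not> summable a \<Longrightarrow>
      summable (\<lambda>k. (a k)\<^sup>2 * expectation (\<lambda>\<omega>. (X k \<omega>)\<^sup>2)) \<Longrightarrow> AE \<omega> in M. (\<lambda>k. x k \<omega>) \<longlonglongrightarrow> 0"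
    and relaxation_weighted_summable:
      "summable (\<lambda>k. (a k)\<^sup>2 * expectation (\<lambda>\<omega>. (X k \<omega>)\<^sup>2)) \<Longrightarrow>
      AE \<omega> in M. summable (\<lambda>k. a k * (x k \<omega>)\<^sup>2)"
proof -
  define f where "f k y = (1 - a k) * y" for k y
  define g where "g k y = a k" for k and y :: real
  have x_eq: "x k \<omega> = driven f g (\<lambda>i. X i \<omega>) k" for k \<omega>
    unfolding x_def f_def[abs_def] g_def[abs_def] ..
  have f: "f k \<in> borel_measurable borel" and g: "g k \<in> borel_measurable borel" for k
    unfolding f_def[abs_def] g_def[abs_def] by measurable
  have f_le: "\<bar>f k y\<bar> \<le> (1 - a k) * \<bar>y\<bar>" and g_le: "\<bar>g k y\<bar> \<le> a k" for k y
    using a[of k] by (auto simp: f_def g_def abs_mult)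
  show x_sq: "integrable M (\<lambda>\<omega>. (x k \<omega>)\<^sup>2)" for k
    unfolding x_eq by (rule driven_second_moment(1)[OF indep X_sq X_mean f g f_le g_le])
  show x_step: "expectation (\<lambda>\<omega>. (x (Suc k) \<omega>)\<^sup>2)
      \<le> (1 - a k) * expectation (\<lambda>\<omega>. (x k \<omega>)\<^sup>2) + (a k)\<^sup>2 * expectation (\<lambda>\<omega>. (X k \<omega>)\<^sup>2)" for k
  proof -
    have "expectation (\<lambda>\<omega>. (x (Suc k) \<omega>)\<^sup>2)
      \<le> (1 - a k)\<^sup>2 * expectation (\<lambda>\<omega>. (x k \<omega>)\<^sup>2) + (a k)\<^sup>2 * expectation (\<lambda>\<omega>. (X k \<omega>)\<^sup>2)"
      unfolding x_eq by (rule driven_second_moment(2)[OF indep X_sq X_mean f g f_le g_le])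
    \<comment> \<open>The squared factor is weakened to \<open>1 - a k\<close>, the form in which
      the deterministic lemmas take a contraction.\<close>
    moreover have "(1 - a k)\<^sup>2 \<le> 1 - a k"
      using a[of k] mult_left_le[of "1 - a k" "1 - a k"] by (simp add: power2_eq_square)
    then have "(1 - a k)\<^sup>2 * expectation (\<lambda>\<omega>. (x k \<omega>)\<^sup>2) \<le> (1 - a k) * expectation (\<lambda>\<omega>. (x k \<omega>)\<^sup>2)"
      by (rule mult_right_mono) simp
    ultimately show ?thesis by linarith
  qed
  show "AE \<omega> in M. (\<lambda>k. x k \<omega>) \<longlonglongrightarrow> 0"
    if div: "\<not> summable a" and var: "summable (\<lambda>k. (a k)\<^sup>2 * expectation (\<lambda>\<omega>. (X k \<omega>)\<^sup>2))"
  proof -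
    \<comment> \<open>The second moments of \<open>a k * X k\<close> are the terms of the series in
      \<open>var\<close>; almost every path is then a relaxation perturbed by a convergent
      series.\<close>
    have "AE \<omega> in M. summable (\<lambda>k. a k * X k \<omega>)"
    proof (rule kolmogorov_one_series)
      show "indep_vars (\<lambda>_. borel) (\<lambda>k \<omega>. a k * X k \<omega>) UNIV"
        by (rule indep_vars_compose2[OF indep]) measurable
    qed (use X_sq X_mean var in \<open>simp_all add: power_mult_distrib\<close>)
    then show ?thesis
    proof eventually_elim
      case (elim \<omega>)
      show ?case
        by (rule tendsto_zero_of_relaxation[OF a div elim]) (simp add: x_def)
    qed
  qed
  show "AE \<omega> in M. summable (\<lambda>k. a k * (x k \<omega>)\<^sup>2)"
    if var: "summable (\<lambda>k. (a k)\<^sup>2 * expectation (\<lambda>\<omega>. (X k \<omega>)\<^sup>2))"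
  proof (rule AE_summable_of_summable_integral)
    \<comment> \<open>The second moments contract up to the forcing summed in \<open>var\<close>;
      \<open>AE_summable_of_summable_integral\<close> passes from expectations to paths.\<close>
    have "summable (\<lambda>k. a k * expectation (\<lambda>\<omega>. (x k \<omega>)\<^sup>2))"
      by (rule summable_weighted_of_contraction[OF _ _ _ x_step var]) (use a in auto)
    then show "summable (\<lambda>k. expectation (\<lambda>\<omega>. a k * (x k \<omega>)\<^sup>2))"
      by simp
  qed (use a x_sq in auto)
qed

end

section \<open>Mean squares and matrix norms\<close>

lemma mean_square_finiteD:
  fixes X :: "'w \<Rightarrow> 'b :: real_normed_vector"
  assumes "(\<lambda>\<omega>. norm (X \<omega>)) \<in> borel_measurable M" "mean_square M X < \<infinity>"
  shows "integrable M (\<lambda>\<omega>. (norm (X \<omega>))\<^sup>2)"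
    and "mean_square M X = ennreal (\<integral>\<omega>. (norm (X \<omega>))\<^sup>2 \<partial>M)"
proof -
  show int: "integrable M (\<lambda>\<omega>. (norm (X \<omega>))\<^sup>2)"
    using assms by (intro integrableI_nonneg) (auto simp: mean_square_def)
  show "mean_square M X = ennreal (\<integral>\<omega>. (norm (X \<omega>))\<^sup>2 \<partial>M)"
    unfolding mean_square_def by (rule nn_integral_eq_integral[OF int]) simp
qed

text \<open>Splitting the square of an entry costs a factor 2, Cauchy-Schwarz over the neighbours a
  factor \<open>CARD('n)\<close>, and the sum over the rows a second
  \<open>CARD('n)\<close>.\<close>

lemma matrix_error_bound:
  fixes E E0 :: "real ^ 'd ^ 'n" and x :: "'n \<Rightarrow> 'd \<Rightarrow> real"
  assumes E: "\<And>i c. E $ i $ c = p * E0 $ i $ c + (\<Sum>j\<in>N i. x j c)"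
    and p: "0 \<le> p" "p \<le> 1"
  shows "(norm E)\<^sup>2 \<le> 2 * (real CARD('n))\<^sup>2 * (p * (norm E0)\<^sup>2 + (\<Sum>j\<in>UNIV. \<Sum>c\<in>UNIV. (x j c)\<^sup>2))"
proof -
  let ?n = "real CARD('n)"
  have n: "1 \<le> ?n" by simp
  have entry: "(E $ i $ c)\<^sup>2 \<le> 2 * p * (E0 $ i $ c)\<^sup>2 + 2 * ?n * (\<Sum>j\<in>UNIV. (x j c)\<^sup>2)" for i c
  proof -
    have "(E $ i $ c)\<^sup>2 \<le> 2 * (p * E0 $ i $ c)\<^sup>2 + 2 * (\<Sum>j\<in>N i. x j c)\<^sup>2"
      unfolding E using sum_squares_bound[of "p * E0 $ i $ c" "\<Sum>j\<in>N i. x j c"]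
      by (simp add: power2_sum)
    \<comment> \<open>Using \<open>p * p \<le> p\<close> keeps the bound linear in \<open>p\<close>,
      later the product of the factors \<open>1 - a t\<close>, whose own recursion is
      linear.\<close>
    moreover have "(p * E0 $ i $ c)\<^sup>2 \<le> p * (E0 $ i $ c)\<^sup>2"
      using p mult_right_mono[OF mult_left_le[of p p], of "(E0 $ i $ c)\<^sup>2"]
      by (simp add: power2_eq_square mult_ac)
    moreover have "(\<Sum>j\<in>N i. x j c)\<^sup>2 \<le> ?n * (\<Sum>j\<in>UNIV. (x j c)\<^sup>2)"
    proof -
      have "(\<Sum>j\<in>N i. x j c)\<^sup>2 \<le> real (card (N i)) * (\<Sum>j\<in>N i. (x j c)\<^sup>2)"
        using Cauchy_Schwarz_ineq_sum[of "\<lambda>_. 1" "\<lambda>j. x j c" "N i"] by simp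
      also have "\<dots> \<le> ?n * (\<Sum>j\<in>UNIV. (x j c)\<^sup>2)"
        by (intro mult_mono sum_mono2 of_nat_mono card_mono sum_nonneg) auto
      finally show ?thesis .
    qed
    ultimately show ?thesis by linarith
  qed
  have "(norm E)\<^sup>2 \<le> (\<Sum>i\<in>(UNIV::'n set). \<Sum>c\<in>UNIV. 2 * p * (E0 $ i $ c)\<^sup>2 + 2 * ?n * (\<Sum>j\<in>UNIV. (x j c)\<^sup>2))"
    unfolding norm_matrix_sq[of E] by (intro sum_mono entry)
  also have "\<dots> = 2 * (p * (norm E0)\<^sup>2) + 2 * ?n\<^sup>2 * (\<Sum>c\<in>UNIV. \<Sum>j\<in>UNIV. (x j c)\<^sup>2)"
    unfolding norm_matrix_sq[of E0]
    by (simp add: sum.distrib sum_distrib_left power2_eq_square mult_ac)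
  also have "(\<Sum>c\<in>UNIV. \<Sum>j\<in>UNIV. (x j c)\<^sup>2) = (\<Sum>j\<in>UNIV. \<Sum>c\<in>UNIV. (x j c)\<^sup>2)"
    by (rule sum.swap)
  also have "2 * (p * (norm E0)\<^sup>2) \<le> 2 * ?n\<^sup>2 * (p * (norm E0)\<^sup>2)"
    using p n one_le_power[OF n, of 2] mult_right_mono[of 1 "?n\<^sup>2" "p * (norm E0)\<^sup>2"] by simp
  finally show ?thesis
    by (simp add: algebra_simps)
qed

section \<open>The tracking error\<close>

theorem theorem1:
  fixes M :: "'w measure"
    and C :: "real ^ 'n ^ 'n"
    and \<eta> :: "nat \<Rightarrow> real"
    and s z :: "nat \<Rightarrow> 'w \<Rightarrow> real ^ 'd ^ 'n"
    and \<zeta> :: "'n \<Rightarrow> nat \<Rightarrow> 'w \<Rightarrow> real ^ 'd"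
  assumes prob: "prob_space M"
    and C_nonneg: "\<And>i j. C $ i $ j \<ge> 0"
    and eta_range: "\<And>k. k \<ge> 1 \<Longrightarrow> 0 < \<eta> k \<and> \<eta> k \<le> 1"
    and s_measurable: "\<And>k. k \<ge> 1 \<Longrightarrow> s k \<in> borel_measurable M"
    and zeta_indep: "\<And>i. prob_space.indep_vars M (\<lambda>_. borel) (\<zeta> i) {1..}"
    and zeta_zero_mean: "\<And>i k. k \<ge> 1 \<Longrightarrow> integrable M (\<zeta> i k) \<and> (\<integral>\<omega>. \<zeta> i k \<omega> \<partial>M) = 0"
    and zeta_s_indep: "\<And>i k. k \<ge> 1 \<Longrightarrow> indep_rv M borel (\<zeta> i k) borel (s k)"
    and eta_sum: "\<not> summable (\<lambda>t. \<eta> (Suc t))"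
    and eta_square_sum: "summable (\<lambda>t. (\<eta> (Suc t))\<^sup>2)"
    and noise_sum:
      "\<And>i. (\<Sum>t. ennreal ((\<eta> (Suc t))\<^sup>2) * mean_square M (\<zeta> i (Suc t + 1))) < \<infinity>"
    and z_initial: "z 1 \<in> borel_measurable M"
    and z_step: "\<And>k \<omega>. k \<ge> 1 \<Longrightarrow> \<omega> \<in> space M \<Longrightarrow>
      z (k + 1) \<omega> =
        (1 - \<eta> k) *\<^sub>R (z k \<omega> + C ** s (k + 1) \<omega> - C ** s k \<omega>)
        + \<eta> k *\<^sub>R (C ** s (k + 1) \<omega> + neighbor_noise C \<zeta> (k + 1) \<omega>)"
  shows "(AE \<omega> in M.
            (\<lambda>k. (norm (z k \<omega> - C ** s k \<omega>))\<^sup>2) \<longlonglongrightarrow> 0 \<and>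
            summable (\<lambda>t. \<eta> (Suc t) * (norm (z (Suc t) \<omega> - C ** s (Suc t) \<omega>))\<^sup>2)) \<and>
         ((\<exists>\<sigma>::real. \<forall>i. \<forall>t\<ge>1. mean_square M (\<zeta> i t) \<le> ennreal (\<sigma>\<^sup>2)) \<longrightarrow>
          ((\<exists>\<eta>\<^sub>0 a\<^sub>1. 0 < \<eta>\<^sub>0 \<and> \<eta>\<^sub>0 < 1 \<and> 1 / 2 < a\<^sub>1 \<and> a\<^sub>1 < 1 \<and>
              (\<forall>k\<ge>1. \<eta> k = \<eta>\<^sub>0 / real k powr a\<^sub>1)) \<or>
           (\<exists>\<eta>\<^sub>0. 1 < \<eta>\<^sub>0 \<and> \<eta>\<^sub>0 < 2 \<and> (\<forall>k\<ge>1. \<eta> k = \<eta>\<^sub>0 / (real k + 1)))) \<longrightarrow>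
          mean_square M (\<lambda>\<omega>. z 1 \<omega> - C ** s 1 \<omega>) < \<infinity> \<longrightarrow>
          (\<exists>c>0. \<forall>k\<ge>1. mean_square M (\<lambda>\<omega>. z k \<omega> - C ** s k \<omega>) \<le> ennreal (c * \<eta> k)))"
proof -
  interpret prob_space M by (rule prob)
  \<comment> \<open>Indices are shifted to start at 0: the step from \<open>e (t + 1)\<close> to
    \<open>e (t + 2)\<close> uses \<open>\<eta> (t + 1)\<close> and the noise of time
    \<open>t + 2\<close>. Thus \<open>P k\<close> and \<open>x j c k\<close> describe
    \<open>e (Suc k)\<close>.\<close>
  define a where "a t = \<eta> (Suc t)" for t
  define e where "e k \<omega> = z k \<omega> - C ** s k \<omega>" for k \<omega>
  define X where "X j c t \<omega> = \<zeta> j (t + 2) \<omega> $ c" for j c t \<omega>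
  define x where "x j c k \<omega> = driven (\<lambda>k y. (1 - a k) * y) (\<lambda>k _. a k) (\<lambda>i. X j c i \<omega>) k"
    for j c k \<omega>
  define P where "P k = (\<Prod>t<k. 1 - a t)" for k
  define B where "B = 2 * (real CARD('n))\<^sup>2"
  have B: "0 < B" by (simp add: B_def)
  have a_pos: "0 < a t" and a_le: "a t \<le> 1" for t
    using eta_range[of "Suc t"] by (auto simp: a_def)
  then have a_nonneg: "0 \<le> a t" for t
    by (simp add: less_imp_le)
  have a_div: "\<not> summable a"
    using eta_sum by (simp add: a_def[abs_def])
  have P_bounds: "0 \<le> P k" "P k \<le> 1" for k
    using a_nonneg a_le by (auto simp: P_def intro!: prod_nonneg prod_le_1)
  have P_step: "P (Suc k) = (1 - a k) * P k" for k
    by (simp add: P_def)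
  have P_lim: "P \<longlonglongrightarrow> 0"
    by (rule tendsto_zero_of_contraction[OF a_nonneg a_div]) (simp_all add: P_bounds P_step)
  have P_sum: "summable (\<lambda>k. a k * P k)"
    by (rule summable_weighted_of_contraction[where b = "\<lambda>_. 0"])
       (simp_all add: a_nonneg P_bounds P_step)

  \<comment> \<open>Independence and moments of the noise coordinates\<close>
  have \<zeta>_rv [measurable]: "\<zeta> j k \<in> borel_measurable M" if "k \<ge> 1" for j k
    using zeta_zero_mean[OF that, of j] by auto
  have ms_finite: "mean_square M (\<zeta> j (t + 2)) < \<infinity>" for j t
  proof -
    \<comment> \<open>Every term of a finite series is finite. Removing the weight uses its
      positivity, since \<open>0 * \<infinity> = 0\<close>.\<close>
    have "ennreal ((\<eta> (Suc t))\<^sup>2) * mean_square M (\<zeta> j (Suc t + 1)) < \<infinity>"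
      by (rule ennreal_suminf_lessD[OF noise_sum])
    then show ?thesis
      using a_pos[of t] by (auto simp: a_def ennreal_mult_less_top)
  qed
  have \<zeta>_sq: "integrable M (\<lambda>\<omega>. (norm (\<zeta> j (t + 2) \<omega>))\<^sup>2)"
    and \<zeta>_ms: "mean_square M (\<zeta> j (t + 2)) = ennreal (expectation (\<lambda>\<omega>. (norm (\<zeta> j (t + 2) \<omega>))\<^sup>2))"
    for j t
    using mean_square_finiteD[OF _ ms_finite, of j t] by measurable
  have X_indep: "indep_vars (\<lambda>_. borel) (X j c) UNIV" for j c
  proof -
    have "indep_vars (\<lambda>_. borel) (\<lambda>t. \<zeta> j (t + 2)) UNIV"
    proof (rule indep_vars_reindex)
      show "indep_vars (\<lambda>_. borel) (\<zeta> j) (range (\<lambda>t. t + 2))"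
        by (rule indep_vars_subset[OF zeta_indep]) auto
    qed (simp add: inj_def)
    then show ?thesis
      unfolding X_def[abs_def]
      by (rule indep_vars_compose2) (intro borel_measurable_continuous_onI continuous_intros)
  qed
  have X_rv: "X j c t \<in> borel_measurable M" for j c t
    using X_indep[of j c] by (auto simp: indep_vars_def)
  have X_le: "(X j c t \<omega>)\<^sup>2 \<le> (norm (\<zeta> j (t + 2) \<omega>))\<^sup>2" for j c t \<omega>
    unfolding X_def using component_le_norm_cart power_mono[OF _ abs_ge_zero, of _ _ 2] by fastforce
  have X_sq: "integrable M (\<lambda>\<omega>. (X j c t \<omega>)\<^sup>2)" for j c t
    by (rule Bochner_Integration.integrable_bound[OF \<zeta>_sq[of j t]]) (use X_le X_rv in auto)
  have X_mean: "expectation (X j c t) = 0" for j c t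
    using integral_bounded_linear[OF bounded_linear_vec_nth[of c], of M "\<zeta> j (t + 2)"]
      zeta_zero_mean[of "t + 2" j] by (simp add: X_def[abs_def])
  have X_var_le: "expectation (\<lambda>\<omega>. (X j c t \<omega>)\<^sup>2) \<le> expectation (\<lambda>\<omega>. (norm (\<zeta> j (t + 2) \<omega>))\<^sup>2)"
    for j c t
    by (rule integral_mono[OF X_sq \<zeta>_sq X_le])
  have X_var: "summable (\<lambda>t. (a t)\<^sup>2 * expectation (\<lambda>\<omega>. (X j c t \<omega>)\<^sup>2))" for j c
  proof -
    let ?v = "\<lambda>t. (a t)\<^sup>2 * expectation (\<lambda>\<omega>. (norm (\<zeta> j (t + 2) \<omega>))\<^sup>2)"
    have "(\<Sum>t. ennreal (?v t)) = (\<Sum>t. ennreal ((\<eta> (Suc t))\<^sup>2) * mean_square M (\<zeta> j (Suc t + 1)))"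
      using \<zeta>_ms[of j] by (simp add: a_def ennreal_mult)
    with noise_sum[of j] have "summable ?v"
      by (intro summable_suminf_not_top) auto
    then show ?thesis
      by (rule summable_comparison_test'[where N = 0]) (use mult_left_mono[OF X_var_le] in auto)
  qed

  \<comment> \<open>Scalar recursions and their superposition\<close>
  have x_step: "x j c (Suc k) \<omega> = (1 - a k) * x j c k \<omega> + a k * X j c k \<omega>" for j c k \<omega>
    by (simp add: x_def)
  note x_facts = X_indep X_sq X_mean a_nonneg a_le
  have x_sq: "integrable M (\<lambda>\<omega>. (x j c k \<omega>)\<^sup>2)" for j c k
    unfolding x_def by (rule relaxation_square_integrable[OF x_facts])
  have x_moment: "expectation (\<lambda>\<omega>. (x j c (Suc k) \<omega>)\<^sup>2)
      \<le> (1 - a k) * expectation (\<lambda>\<omega>. (x j c k \<omega>)\<^sup>2) + (a k)\<^sup>2 * expectation (\<lambda>\<omega>. (X j c k \<omega>)\<^sup>2)"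
    for j c k
    unfolding x_def by (rule relaxation_second_moment[OF x_facts])
  have x_lim: "AE \<omega> in M. (\<lambda>k. x j c k \<omega>) \<longlonglongrightarrow> 0" for j c
    unfolding x_def by (rule relaxation_tendsto_zero[OF x_facts a_div X_var])
  have x_sum: "AE \<omega> in M. summable (\<lambda>k. a k * (x j c k \<omega>)\<^sup>2)" for j c
    unfolding x_def by (rule relaxation_weighted_summable[OF x_facts X_var])

  have e_step: "e (Suc k) \<omega> = (1 - \<eta> k) *\<^sub>R e k \<omega> + \<eta> k *\<^sub>R neighbor_noise C \<zeta> (k + 1) \<omega>"
    if "k \<ge> 1" "\<omega> \<in> space M" for k \<omega>
    \<comment> \<open>\<open>C ** s (k + 1)\<close> enters with weights \<open>1 - \<eta> k\<close>
      and \<open>\<eta> k\<close> of sum 1, so it cancels against the term subtracted in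
      \<open>e (Suc k)\<close>.\<close>
    using z_step[OF that] by (simp add: e_def algebra_simps)
  \<comment> \<open>By linearity, neighbour sums of the scalar recursions solve the recursion of the
    entry; at \<open>k = 0\<close> the product is 1 and the driven parts vanish.\<close>
  have e_entry: "e (Suc k) \<omega> $ i $ c = P k * e 1 \<omega> $ i $ c + (\<Sum>j\<in>in_neighbors C i. x j c k \<omega>)"
    if \<omega>: "\<omega> \<in> space M" for k \<omega> i c
  proof (induction k)
    case (Suc k)
    have "e (Suc (Suc k)) \<omega> $ i $ c
        = (1 - a k) * e (Suc k) \<omega> $ i $ c + a k * (\<Sum>j\<in>in_neighbors C i. X j c k \<omega>)"
      using e_step[of "Suc k" \<omega>] \<omega> by (simp add: a_def X_def neighbor_noise_def)
    then show ?case
      unfolding Suc.IH x_step P_step sum.distrib sum_distrib_left[symmetric]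
      by (simp add: algebra_simps)
  qed (simp add: P_def x_def)
  have e_bound: "(norm (e (Suc k) \<omega>))\<^sup>2
      \<le> B * (P k * (norm (e 1 \<omega>))\<^sup>2 + (\<Sum>j\<in>UNIV. \<Sum>c\<in>UNIV. (x j c k \<omega>)\<^sup>2))"
    if "\<omega> \<in> space M" for k \<omega>
    unfolding B_def by (rule matrix_error_bound[OF e_entry[OF that] P_bounds])

  \<comment> \<open>Almost sure limit and weighted sum\<close>
  have "AE \<omega> in M. (\<forall>j c. (\<lambda>k. x j c k \<omega>) \<longlonglongrightarrow> 0) \<and> (\<forall>j c. summable (\<lambda>k. a k * (x j c k \<omega>)\<^sup>2))"
    using x_lim x_sum by (simp add: AE_all_countable)
  with AE_space have almost_surely: "AE \<omega> in M. (\<lambda>k. (norm (e k \<omega>))\<^sup>2) \<longlonglongrightarrow> 0 \<and>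
      summable (\<lambda>t. \<eta> (Suc t) * (norm (e (Suc t) \<omega>))\<^sup>2)"
  proof eventually_elim
    case (elim \<omega>)
    \<comment> \<open>On a fixed path \<open>norm (e 1 \<omega>)\<close> is a constant, so this
      majorant tends to 0 along with \<open>P\<close> and the finitely many \<open>x j c\<close>;
      multiplied by \<open>a k\<close> it is summable.\<close>
    let ?W = "\<lambda>k. B * (P k * (norm (e 1 \<omega>))\<^sup>2 + (\<Sum>j\<in>UNIV. \<Sum>c\<in>UNIV. (x j c k \<omega>)\<^sup>2))"
    have "?W \<longlonglongrightarrow> B * (0 * (norm (e 1 \<omega>))\<^sup>2 + (\<Sum>j\<in>(UNIV::'n set). \<Sum>c\<in>(UNIV::'d set). 0\<^sup>2))"
      using elim by (intro tendsto_intros P_lim) auto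
    then have W: "?W \<longlonglongrightarrow> 0" by simp
    have "(\<lambda>k. (norm (e (Suc k) \<omega>))\<^sup>2) \<longlonglongrightarrow> 0"
      by (rule tendsto_sandwich[OF _ _ tendsto_const W]) (use e_bound elim in auto)
    then have lim: "(\<lambda>k. (norm (e k \<omega>))\<^sup>2) \<longlonglongrightarrow> 0"
      by (rule LIMSEQ_imp_Suc)
    have "summable (\<lambda>k. B * ((a k * P k) * (norm (e 1 \<omega>))\<^sup>2 + (\<Sum>j\<in>UNIV. \<Sum>c\<in>UNIV. a k * (x j c k \<omega>)\<^sup>2)))"
      using elim by (intro summable_mult summable_add summable_mult2 P_sum summable_sum) auto
    also have "(\<lambda>k. B * ((a k * P k) * (norm (e 1 \<omega>))\<^sup>2 + (\<Sum>j\<in>UNIV. \<Sum>c\<in>UNIV. a k * (x j c k \<omega>)\<^sup>2)))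
        = (\<lambda>k. a k * ?W k)"
      by (simp add: fun_eq_iff algebra_simps sum_distrib_left)
    finally have "summable (\<lambda>k. a k * (norm (e (Suc k) \<omega>))\<^sup>2)"
      by (rule summable_comparison_test'[where N = 0])
         (use e_bound elim a_nonneg in \<open>auto intro!: mult_left_mono\<close>)
    with lim show ?case
      by (simp add: a_def)
  qed

  \<comment> \<open>Mean-square rate\<close>
  have rate: "\<exists>c>0. \<forall>k\<ge>1. mean_square M (e k) \<le> ennreal (c * \<eta> k)"
    if \<sigma>: "\<And>i t. t \<ge> 1 \<Longrightarrow> mean_square M (\<zeta> i t) \<le> ennreal (\<sigma>\<^sup>2)"
      and q: "q < 1" and slow: "\<And>k. k \<ge> K \<Longrightarrow> a k - a (Suc k) \<le> q * (a k)\<^sup>2"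
      and e1: "mean_square M (e 1) < \<infinity>"
    for \<sigma> q :: real and K :: nat
  proof -
    \<comment> \<open>With \<open>S = 0\<close> the comparison shows that the initial error is
      damped at least at the rate of \<open>a\<close>.\<close>
    have "\<exists>c>0. \<forall>k. P k \<le> c * a k"
      by (rule bounded_by_stepsize[where a = a and q = q and K = K and S = 0, OF a_pos a_le q slow]) (simp_all add: P_step)
    then obtain cP where cP: "cP > 0" "\<And>k. P k \<le> cP * a k"
      by blast
    \<comment> \<open>Here \<open>S = \<sigma>\<^sup>2\<close>, since a coordinate has at most the
      second moment of the whole noise vector.\<close>
    have "\<exists>c'>0. \<forall>k. expectation (\<lambda>\<omega>. (x j c k \<omega>)\<^sup>2) \<le> c' * a k" for j c
    proof (rule bounded_by_stepsize[where a = a and q = q and K = K, OF a_pos a_le q slow])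
      fix k
      have "expectation (\<lambda>\<omega>. (X j c k \<omega>)\<^sup>2) \<le> \<sigma>\<^sup>2"
        using X_var_le[of j c k] \<sigma>[of "k + 2" j] \<zeta>_ms[of j k] by simp
      then have "(a k)\<^sup>2 * expectation (\<lambda>\<omega>. (X j c k \<omega>)\<^sup>2) \<le> (a k)\<^sup>2 * \<sigma>\<^sup>2"
        by (intro mult_left_mono) auto
      then show "expectation (\<lambda>\<omega>. (x j c (Suc k) \<omega>)\<^sup>2)
          \<le> (1 - a k) * expectation (\<lambda>\<omega>. (x j c k \<omega>)\<^sup>2) + (a k)\<^sup>2 * \<sigma>\<^sup>2"
        using x_moment[of j c k] by linarith
    qed
    then obtain cx where cx: "\<And>j c. cx j c > 0" "\<And>j c k. expectation (\<lambda>\<omega>. (x j c k \<omega>)\<^sup>2) \<le> cx j c * a k"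
      by metis
    let ?m = "expectation (\<lambda>\<omega>. (norm (e 1 \<omega>))\<^sup>2)"
    define c0 where "c0 = B * (cP * ?m + (\<Sum>j\<in>UNIV. \<Sum>c\<in>UNIV. cx j c))"
    have [measurable]: "z 1 \<in> borel_measurable M" "s 1 \<in> borel_measurable M"
      using z_initial s_measurable[of 1] by auto
    have mult_cont: "continuous_on UNIV (\<lambda>A :: real ^ 'd ^ 'n. C ** A)"
      by (auto simp: matrix_matrix_mult_def intro!: continuous_intros)
    have "(\<lambda>\<omega>. C ** s 1 \<omega>) \<in> borel_measurable M"
      by (rule measurable_compose[OF s_measurable borel_measurable_continuous_onI[OF mult_cont]]) simp
    then have [measurable]: "e 1 \<in> borel_measurable M"
      unfolding e_def[abs_def] by measurable
    \<comment> \<open>The initial error enters through its second moment; \<open>e1\<close> ensures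
      that \<open>?m\<close> is its true value and not the default 0 of a non-integrable
      function.\<close>
    have e1_sq: "integrable M (\<lambda>\<omega>. (norm (e 1 \<omega>))\<^sup>2)"
      by (rule mean_square_finiteD(1)[OF _ e1]) measurable
    have main: "mean_square M (e (Suc k)) \<le> ennreal (c0 * a k)" for k
    proof -
      let ?W = "\<lambda>\<omega>. B * (P k * (norm (e 1 \<omega>))\<^sup>2 + (\<Sum>j\<in>UNIV. \<Sum>c\<in>UNIV. (x j c k \<omega>)\<^sup>2))"
      have W_int: "integrable M ?W"
        using e1_sq x_sq by auto
      have "mean_square M (e (Suc k)) \<le> (\<integral>\<^sup>+\<omega>. ennreal (?W \<omega>) \<partial>M)"
        unfolding mean_square_def by (intro nn_integral_mono ennreal_leI e_bound)
      also have "\<dots> = ennreal (expectation ?W)"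
        using B P_bounds by (intro nn_integral_eq_integral[OF W_int] AE_I2)
           (simp add: sum_nonneg)
      also have "expectation ?W
          = B * (P k * ?m + (\<Sum>j\<in>UNIV. \<Sum>c\<in>UNIV. expectation (\<lambda>\<omega>. (x j c k \<omega>)\<^sup>2)))"
        using e1_sq x_sq by simp
      also have "\<dots> \<le> B * ((cP * a k) * ?m + (\<Sum>j\<in>UNIV. \<Sum>c\<in>UNIV. cx j c * a k))"
        using B cP cx by (intro mult_left_mono add_mono mult_right_mono sum_mono) auto
      also have "\<dots> = c0 * a k"
        by (simp add: c0_def algebra_simps sum_distrib_left)
      finally show ?thesis by (simp add: ennreal_leI)
    qed
    have c0: "0 \<le> c0"
      using B cP cx by (auto simp: c0_def less_imp_le intro!: mult_nonneg_nonneg add_nonneg_nonneg sum_nonneg)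
    \<comment> \<open>The summand 1 makes the constant strictly positive, given only
      \<open>0 \<le> c0\<close>.\<close>
    have "mean_square M (e k) \<le> ennreal ((c0 + 1) * \<eta> k)" if "k \<ge> 1" for k
    proof -
      have "mean_square M (e k) \<le> ennreal (c0 * \<eta> k)"
        using main[of "k - 1"] that by (simp add: a_def)
      also have "\<dots> \<le> ennreal ((c0 + 1) * \<eta> k)"
        using eta_range[OF that] by (intro ennreal_leI mult_right_mono) auto
      finally show ?thesis .
    qed
    with c0 show ?thesis
      by (intro exI[of _ "c0 + 1"]) auto
  qed

  \<comment> \<open>Slow decrease of the two step-size schedules\<close>
  have slow: "\<exists>q K. q < 1 \<and> (\<forall>k\<ge>K. a k - a (Suc k) \<le> q * (a k)\<^sup>2)"
    if "(\<exists>\<eta>\<^sub>0 a\<^sub>1. 0 < \<eta>\<^sub>0 \<and> \<eta>\<^sub>0 < 1 \<and> 1 / 2 < a\<^sub>1 \<and> a\<^sub>1 < 1 \<and>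
              (\<forall>k\<ge>1. \<eta> k = \<eta>\<^sub>0 / real k powr a\<^sub>1)) \<or>
           (\<exists>\<eta>\<^sub>0. 1 < \<eta>\<^sub>0 \<and> \<eta>\<^sub>0 < 2 \<and> (\<forall>k\<ge>1. \<eta> k = \<eta>\<^sub>0 / (real k + 1)))"
    using that
  proof (elim disjE exE conjE)
    fix \<eta>\<^sub>0 p :: real
    assume "0 < \<eta>\<^sub>0" "1 / 2 < p" "p < 1" and \<eta>: "\<forall>k\<ge>1. \<eta> k = \<eta>\<^sub>0 / real k powr p"
    then obtain K where "\<forall>k\<ge>K. \<eta>\<^sub>0 / real (Suc k) powr p - \<eta>\<^sub>0 / real (Suc (Suc k)) powr p
        \<le> 1/2 * (\<eta>\<^sub>0 / real (Suc k) powr p)\<^sup>2"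
      using power_stepsize_slow[of \<eta>\<^sub>0 p] by (auto simp: eventually_at_top_linorder)
    then have "\<forall>k\<ge>K. a k - a (Suc k) \<le> 1/2 * (a k)\<^sup>2"
      using \<eta> by (simp add: a_def)
    then show ?thesis
      by (intro exI[of _ "1/2"] exI[of _ K]) simp
  next
    fix \<eta>\<^sub>0 :: real
    assume "1 < \<eta>\<^sub>0" and \<eta>: "\<forall>k\<ge>1. \<eta> k = \<eta>\<^sub>0 / (real k + 1)"
    have "a k - a (Suc k) \<le> (1 / \<eta>\<^sub>0) * (a k)\<^sup>2" for k
      using harmonic_stepsize_slow[OF \<open>1 < \<eta>\<^sub>0\<close>, of k] \<eta> by (simp add: a_def del: of_nat_Suc)
    with \<open>1 < \<eta>\<^sub>0\<close> show ?thesis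
      by (intro exI[of _ "1 / \<eta>\<^sub>0"] exI[of _ 0]) simp
  qed
  show ?thesis
  proof (intro conjI impI, goal_cases)
    case 1
    show ?case
      using almost_surely by (simp add: e_def)
  next
    case 2
    obtain \<sigma> :: real where \<sigma>: "\<And>i t. t \<ge> 1 \<Longrightarrow> mean_square M (\<zeta> i t) \<le> ennreal (\<sigma>\<^sup>2)"
      using 2(1) by blast
    obtain q K where q: "q < 1" and K: "\<And>k. k \<ge> K \<Longrightarrow> a k - a (Suc k) \<le> q * (a k)\<^sup>2"
      using slow[OF 2(2)] by blast
    have e1: "mean_square M (e 1) < \<infinity>"
      using 2(3) by (simp add: e_def[abs_def])
    show ?case
      using rate[OF \<sigma> q K e1] by (simp add: e_def[abs_def])
  qed
qed

end
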